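(* Let $m$ be a positive integer and let $A>1$. Then every positive solution $\{(x_n,y_n,z_n)\}_{n\ge -m}$ of the system $$x_{n+1}=A+\frac{x_{n-m}}{z_n},\quad y_{n+1}=A+\frac{y_{n-m}}{z_n},\quad z_{n+1}=A+\frac{z_{n-m}}{y_n},\qquad n=0,1,2,\dots$$ is bounded and persists.
   Context: A positive solution of the system is a sequence $\{(x_n,y_n,z_n)\}_{n\ge -m}$ satisfying the recursion for all $n\ge 0$ whose initial values $x_{-i},y_{-i},z_{-i}$, $i=0,1,\dots,m$, are positive real numbers. A positive solution is bounded and persists if there exist constants $0<P\le Q<\infty$ (possibly depending on the solution) such that $P\le x_n,y_n,z_n\le Q$ for all $n\ge -m$. *)

theory Defs
  imports Complex_Main
begin

text \<open>Sequences \<open>(x\<^sub>n)\<close> with \<open>n \<ge> -m\<close> are functions on \<^typ>\<open>int\<close>; their values at indices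
  below \<open>-m\<close> are irrelevant and are not constrained by any of the definitions.\<close>

definition solves_system ::
    "nat \<Rightarrow> real \<Rightarrow> (int \<Rightarrow> real) \<Rightarrow> (int \<Rightarrow> real) \<Rightarrow> (int \<Rightarrow> real) \<Rightarrow> bool" where
  "solves_system m A x y z \<longleftrightarrow>
     (\<forall>n\<ge>0. x (n + 1) = A + x (n - int m) / z n \<and>
            y (n + 1) = A + y (n - int m) / z n \<and>
            z (n + 1) = A + z (n - int m) / y n)"

definition positive_solution ::
    "nat \<Rightarrow> real \<Rightarrow> (int \<Rightarrow> real) \<Rightarrow> (int \<Rightarrow> real) \<Rightarrow> (int \<Rightarrow> real) \<Rightarrow> bool" where
  "positive_solution m A x y z \<longleftrightarrow>
     solves_system m A x y z \<and>
     (\<forall>i\<in>{0..m}. x (- int i) > 0 \<and> y (- int i) > 0 \<and> z (- int i) > 0)"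

definition bounded_and_persists ::
    "nat \<Rightarrow> (int \<Rightarrow> real) \<Rightarrow> (int \<Rightarrow> real) \<Rightarrow> (int \<Rightarrow> real) \<Rightarrow> bool" where
  "bounded_and_persists m x y z \<longleftrightarrow>
     (\<exists>P Q. 0 < P \<and> P \<le> Q \<and>
        (\<forall>n\<ge>- int m. x n \<in> {P..Q} \<and> y n \<in> {P..Q} \<and> z n \<in> {P..Q}))"

end

theory Submission
  imports Defs
begin

text \<open>All terms of index at least 1 exceed \<open>A\<close>, so from then on every division is by more than
  \<open>A > 1\<close> and each of the three sequences satisfies \<open>u\<^sub>n\<^sub>+\<^sub>1 \<le> A + u\<^sub>n\<^sub>-\<^sub>m / A\<close>. The
  map \<open>t \<mapsto> A + t / A\<close> sends every interval \<open>(-\<infinity>, Q]\<close> with \<open>Q \<ge> A\<^sup>2 / (A - 1)\<close> into itself.\<close>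

lemma delayed_contraction_bounded_above:
  fixes A :: real and u :: "int \<Rightarrow> real"
  assumes "A > 1" and step: "\<And>n. n \<ge> 1 \<Longrightarrow> u (n + 1) \<le> A + u (n - int m) / A"
  shows "\<exists>Q. \<forall>n\<ge>- int m. u n \<le> Q"
proof -
  \<comment> \<open>\<open>A\<^sup>2 / (A - 1)\<close> is the fixed point of
    \<open>t \<mapsto> A + t / A\<close>. The window runs up to index 1 because \<open>step\<close>
    first controls \<open>u 2\<close>.\<close>
  define S where "S = insert (A\<^sup>2 / (A - 1)) (u ` {- int m..1})"
  define Q where "Q = Max S"
  have Q: "s \<le> Q" if "s \<in> S" for s
    using that unfolding Q_def by (intro Max_ge) (simp_all add: S_def)
  have "A\<^sup>2 / (A - 1) \<le> Q"
    by (rule Q) (simp add: S_def)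
  then have Q_stable: "A + Q / A \<le> Q"
    using \<open>A > 1\<close> by (simp add: field_simps power2_eq_square)
  have "u n \<le> Q" if "n \<ge> - int m" for n
    using that
  proof (induction "nat (n + int m)" arbitrary: n rule: less_induct)
    case less
    show ?case
    proof (cases "n \<le> 1")
      case True
      then show ?thesis using less.prems by (intro Q) (simp add: S_def)
    next
      case False
      have "u (n - 1 - int m) \<le> Q"
        using False less.prems by (intro less.hyps) auto
      then have "A + u (n - 1 - int m) / A \<le> A + Q / A"
        using \<open>A > 1\<close> by (simp add: divide_right_mono)
      then show ?thesis using step[of "n - 1"] Q_stable False by simp
    qed
  qed
  then show ?thesis by blast
qed

text \<open>Each new term is \<open>A\<close> plus a quotient of earlier terms. The recursion
  reaches back \<open>m + 1\<close> places, so the induction is strong, on the distance from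
  \<open>- int m\<close>.\<close>

lemma positive_solution_pos:
  assumes "A > 0" and sol: "positive_solution m A x y z" and "n \<ge> - int m"
  shows "x n > 0 \<and> y n > 0 \<and> z n > 0"
  using assms(3)
proof (induction "nat (n + int m)" arbitrary: n rule: less_induct)
  case less
  show ?case
  proof (cases "n \<le> 0")
    case True
    then have "nat (- n) \<in> {0..m}" "n = - int (nat (- n))" using less.prems by auto
    then show ?thesis using sol unfolding positive_solution_def by metis
  next
    case False
    have "x (n - 1 - int m) > 0 \<and> y (n - 1 - int m) > 0 \<and> z (n - 1 - int m) > 0"
      using False less.prems by (intro less.hyps) auto
    moreover have "x (n - 1) > 0 \<and> y (n - 1) > 0 \<and> z (n - 1) > 0"
      using False less.prems by (intro less.hyps) auto
    moreover have "x (n - 1 + 1) = A + x (n - 1 - int m) / z (n - 1)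
        \<and> y (n - 1 + 1) = A + y (n - 1 - int m) / z (n - 1)
        \<and> z (n - 1 + 1) = A + z (n - 1 - int m) / y (n - 1)"
      using False sol[unfolded positive_solution_def solves_system_def, THEN conjunct1,
          THEN spec, of "n - 1"] by linarith
    ultimately show ?thesis using \<open>A > 0\<close> by (simp add: add_pos_pos)
  qed
qed

text \<open>Covers all three equations, with \<open>(u, v)\<close> being \<open>(x, z)\<close>,
  \<open>(y, z)\<close> and \<open>(z, y)\<close>. The upper bound comes from the contraction, the
  lower one from \<open>A\<close> and the finitely many initial values.\<close>

lemma delayed_recursion_bounded:
  fixes A :: real and u v :: "int \<Rightarrow> real"
  assumes "A > 1"
    and rec: "\<And>n. n \<ge> 0 \<Longrightarrow> u (n + 1) = A + u (n - int m) / v n"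
    and u_pos: "\<And>n. n \<ge> - int m \<Longrightarrow> u n > 0"
    and v_pos: "\<And>n. n \<ge> 0 \<Longrightarrow> v n > 0"
    and v_ge: "\<And>n. n \<ge> 1 \<Longrightarrow> v n \<ge> A"
  shows "\<exists>P Q. 0 < P \<and> (\<forall>n\<ge>- int m. P \<le> u n \<and> u n \<le> Q)"
proof -
  \<comment> \<open>Index 0 is excluded: \<open>v 0\<close> is an initial value in the application
    and may be arbitrarily small.\<close>
  have "u (n + 1) \<le> A + u (n - int m) / A" if "n \<ge> 1" for n
    using that rec[of n] u_pos[of "n - int m"] v_ge[of n] \<open>A > 1\<close>
    by (simp add: divide_left_mono)
  then obtain Q where Q: "\<forall>n\<ge>- int m. u n \<le> Q"
    using delayed_contraction_bounded_above \<open>A > 1\<close> by blast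
  \<comment> \<open>Here the window can stop at 0: positivity of \<open>v\<close> alone already
    gives \<open>u n \<ge> A\<close> from index 1 on.\<close>
  define S where "S = insert A (u ` {- int m..0})"
  have "Min S > 0"
    using \<open>A > 1\<close> u_pos by (simp add: S_def)
  moreover have "Min S \<le> u n" if "n \<ge> - int m" for n
  proof (cases "n \<le> 0")
    case True
    then show ?thesis using that by (intro Min_le) (simp_all add: S_def)
  next
    case False
    have "Min S \<le> A" by (simp add: S_def)
    also have "A \<le> u n"
      using False rec[of "n - 1"] u_pos[of "n - 1 - int m"] v_pos[of "n - 1"] by simp
    finally show ?thesis .
  qed
  ultimately show ?thesis using Q by blast
qed

theorem theorem3p5:
  fixes m :: nat and A :: real and x y z :: "int \<Rightarrow> real"
  assumes "m > 0" and "A > 1"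
    and "positive_solution m A x y z"
  shows "bounded_and_persists m x y z"
proof -
  have rec: "x (n + 1) = A + x (n - int m) / z n"
      "y (n + 1) = A + y (n - int m) / z n"
      "z (n + 1) = A + z (n - int m) / y n" if "n \<ge> 0" for n
    using that assms(3) by (auto simp: positive_solution_def solves_system_def)
  have pos: "x n > 0" "y n > 0" "z n > 0" if "n \<ge> - int m" for n
    using positive_solution_pos[of A m x y z n] assms that by auto
  have ge: "y n \<ge> A" "z n \<ge> A" if "n \<ge> 1" for n
    using that rec[of "n - 1"] pos[of "n - 1"] pos[of "n - 1 - int m"] by auto
  obtain P1 Q1 where 1: "0 < P1" "\<forall>n\<ge>- int m. P1 \<le> x n \<and> x n \<le> Q1"
    using delayed_recursion_bounded[of A x m z] \<open>A > 1\<close> rec pos ge by auto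
  obtain P2 Q2 where 2: "0 < P2" "\<forall>n\<ge>- int m. P2 \<le> y n \<and> y n \<le> Q2"
    using delayed_recursion_bounded[of A y m z] \<open>A > 1\<close> rec pos ge by auto
  obtain P3 Q3 where 3: "0 < P3" "\<forall>n\<ge>- int m. P3 \<le> z n \<and> z n \<le> Q3"
    using delayed_recursion_bounded[of A z m y] \<open>A > 1\<close> rec pos ge by auto
  define P where "P = min P1 (min P2 P3)"
  define Q where "Q = max Q1 (max Q2 Q3)"
  have bounds: "x n \<in> {P..Q} \<and> y n \<in> {P..Q} \<and> z n \<in> {P..Q}" if "n \<ge> - int m" for n
    using 1(2) 2(2) 3(2) that by (auto simp: P_def Q_def min_le_iff_disj le_max_iff_disj)
  moreover have "0 < P" using 1 2 3 by (simp add: P_def)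
  \<comment> \<open>The interval \<open>{P..Q}\<close> is nonempty, since it contains
    \<open>x 0\<close>.\<close>
  moreover have "P \<le> Q" using bounds[of 0] by simp
  ultimately show ?thesis unfolding bounded_and_persists_def by blast
qed

end
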